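(* If $p\ge k\ge3$, then the broom $\mathcal B_{k,p}$ has no Braess edge joining a vertex of the path part to a pendent vertex of the star part; that is, $B_2=0$.
   Context: For $k\ge3$ and $p\ge2$, the broom $\mathcal B_{k,p}$ is obtained from the path $\mathcal P_k=(1,\dots,k)$ and a star with $p$ leaves by identifying vertex $k$ of the path with the star's center; the $p$ leaves are the pendent vertices of the star part. $B_2$ denotes the number of Braess edges of $\mathcal B_{k,p}$ joining a vertex of $\mathcal P_k$ to a pendent vertex of the star part. For a connected graph $G$, $\kappa(G)$ is Kemeny's constant of the simple random walk on $G$: $\kappa(G)=\sum_{j\ne i}m_{ij}\pi_j$ ($m_{ij}$ mean first passage time, $\pi$ stationary distribution); a pair of nonadjacent vertices is a Braess edge if adding the edge between them strictly increases $\kappa$. *)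

theory Defs
  imports "HOL-Probability.Probability"
begin

text \<open>
  A finite simple graph is given by its vertex set \<open>V\<close> and its set \<open>E\<close> of edges, each edge
  being a two-element subset of \<open>V\<close>.
\<close>

definition neighbours :: "'a set set \<Rightarrow> 'a \<Rightarrow> 'a set" where
  "neighbours E u = {v. {u, v} \<in> E}"

definition rw_step :: "'a set set \<Rightarrow> 'a \<Rightarrow> 'a pmf" where
  "rw_step E u = pmf_of_set (neighbours E u)"

text \<open>Law of the trajectory \<open>[X\<^sub>1, \<dots>, X\<^sub>n]\<close> of the walk started at \<open>X\<^sub>0 = u\<close>.\<close>

primrec rw_path :: "'a set set \<Rightarrow> nat \<Rightarrow> 'a \<Rightarrow> 'a list pmf" where
  "rw_path E 0 u = return_pmf []"
| "rw_path E (Suc n) u =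
     bind_pmf (rw_step E u) (\<lambda>v. map_pmf (\<lambda>xs. v # xs) (rw_path E n v))"

text \<open>
  Probability that the walk started at \<open>i\<close> satisfies \<open>min {t \<ge> 1. X\<^sub>t = j} = n\<close>.
\<close>

definition first_passage_prob :: "'a set set \<Rightarrow> 'a \<Rightarrow> 'a \<Rightarrow> nat \<Rightarrow> real" where
  "first_passage_prob E i j n =
     measure_pmf.prob (rw_path E n i) {xs. xs \<noteq> [] \<and> last xs = j \<and> j \<notin> set (butlast xs)}"

text \<open>
  On a finite connected graph with at least two vertices the walk reaches \<open>j\<close> almost surely
  and the series converges.
\<close>

definition mean_first_passage :: "'a set set \<Rightarrow> 'a \<Rightarrow> 'a \<Rightarrow> real" where
  "mean_first_passage E i j = (\<Sum>n. real n * first_passage_prob E i j n)"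

definition stationary_dist :: "'a set \<Rightarrow> 'a set set \<Rightarrow> 'a pmf" where
  "stationary_dist V E = (THE \<pi>. set_pmf \<pi> \<subseteq> V \<and> bind_pmf \<pi> (rw_step E) = \<pi>)"

text \<open>
  The sum does not depend on the initial vertex \<open>i\<close> when the graph is connected; this common
  value is Kemeny's constant.
\<close>

definition kemeny :: "'a set \<Rightarrow> 'a set set \<Rightarrow> real" where
  "kemeny V E =
     (THE c. \<forall>i\<in>V. (\<Sum>j\<in>V - {i}. mean_first_passage E i j * pmf (stationary_dist V E) j) = c)"

definition braess_edges :: "'a set \<Rightarrow> 'a set set \<Rightarrow> 'a set set" where
  "braess_edges V E =
     {{u, v} | u v. u \<in> V \<and> v \<in> V \<and> u \<noteq> v \<and> {u, v} \<notin> E \<and>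
        kemeny V (insert {u, v} E) > kemeny V E}"

text \<open>
  In the broom the path is \<open>1, \<dots>, k\<close>, its end \<open>k\<close> is the centre of the star, and the pendent
  vertices of the star are \<open>k + 1, \<dots>, k + p\<close>.
\<close>

definition broom_path :: "nat \<Rightarrow> nat set" where
  "broom_path k = {1..k}"

definition broom_leaves :: "nat \<Rightarrow> nat \<Rightarrow> nat set" where
  "broom_leaves k p = {k + 1..k + p}"

definition broom_verts :: "nat \<Rightarrow> nat \<Rightarrow> nat set" where
  "broom_verts k p = broom_path k \<union> broom_leaves k p"

definition broom_edges :: "nat \<Rightarrow> nat \<Rightarrow> nat set set" where
  "broom_edges k p =
     {{i, i + 1} | i. 1 \<le> i \<and> i < k} \<union> {{k, j} | j. j \<in> broom_leaves k p}"

definition broom_B2 :: "nat \<Rightarrow> nat \<Rightarrow> nat" where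
  "broom_B2 k p =
     card {e \<in> braess_edges (broom_verts k p) (broom_edges k p).
            \<exists>i\<in>broom_path k. \<exists>j\<in>broom_leaves k p. e = {i, j}}"

end

theory Submission
  imports Defs
begin

text \<open>
  Kemeny's constant of a graph with \<open>m\<close> edges is \<open>(\<Sum>x y. d\<^sub>x d\<^sub>y R\<^sub>x\<^sub>y) / (4 m)\<close>, where \<open>d\<close> are the degrees
  and \<open>R\<close> the effective resistances: the hitting time of \<open>j\<close> from \<open>u\<close> is
  \<open>(\<Sum>z. d\<^sub>z (R\<^sub>u\<^sub>j + R\<^sub>j\<^sub>z - R\<^sub>u\<^sub>z)) / 2\<close>, because this expression solves the first-step equations. In the
  broom, a tree, \<open>R\<close> is the graph distance, and adding an edge \<open>ab\<close> subtracts
  \<open>(g\<^sub>x - g\<^sub>y)\<^sup>2 / (1 + R\<^sub>a\<^sub>b)\<close> from \<open>R\<^sub>x\<^sub>y\<close>, where \<open>2 g = R(\<cdot>, a) - R(\<cdot>, b)\<close>. Comparing both constants thus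
  amounts to a polynomial inequality in \<open>k\<close>, \<open>p\<close> and \<open>c = k - i\<close>, where \<open>i\<close> is the path end of the new
  edge. Substituting \<open>k = c + 1 + r\<close> and \<open>p = k + q\<close>, its coefficients become nonnegative once \<open>c = 2 + d\<close>,
  or \<open>c = 1\<close> and \<open>r\<close> is replaced by \<open>1 + r\<close>.
\<close>

section \<open>Random walks and hitting times\<close>

abbreviation valency :: "'a set set \<Rightarrow> 'a \<Rightarrow> real" where
  "valency E u \<equiv> real (card (neighbours E u))"

lemma neighbours_sym: "v \<in> neighbours E u \<longleftrightarrow> u \<in> neighbours E v"
  by (simp add: neighbours_def insert_commute)

locale finite_walk =
  fixes V :: "'a set" and E :: "'a set set"
  assumes finite_V: "finite V"
    and nonempty_V: "V \<noteq> {}"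
    and neighbours_subset: "u \<in> V \<Longrightarrow> neighbours E u \<subseteq> V"
    and neighbours_nonempty: "u \<in> V \<Longrightarrow> neighbours E u \<noteq> {}"
begin

lemma finite_neighbours: "u \<in> V \<Longrightarrow> finite (neighbours E u)"
  using neighbours_subset finite_V finite_subset by blast

lemma valency_pos: "u \<in> V \<Longrightarrow> valency E u > 0"
  using finite_neighbours neighbours_nonempty by (simp add: card_gt_0_iff)

lemma neighbours_in_V: "u \<in> V \<Longrightarrow> v \<in> neighbours E u \<Longrightarrow> v \<in> V"
  using neighbours_subset by blast

text \<open>Condition on the first step. If it leads to \<open>j\<close>, the rest of the trajectory
  must be empty, which happens only for \<open>n = 0\<close>; otherwise the rest is itself a first
  passage.\<close>

lemma first_passage_prob_Suc:
  assumes "u \<in> V"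
  shows "first_passage_prob E u j (Suc n) =
    (\<Sum>v\<in>neighbours E u. if v = j then (if n = 0 then 1 else 0) else first_passage_prob E v j n)
      / valency E u"
proof -
  let ?A = "{xs. xs \<noteq> [] \<and> last xs = j \<and> j \<notin> set (butlast xs)}"
  have vim: "(\<lambda>xs. v # xs) -` ?A = (if v = j then {[]} else ?A)" for v
    by (auto split: if_splits)
  have nil: "measure_pmf.prob (rw_path E n v) {[]} = (if n = 0 then 1 else 0)" for v
    by (cases n) (auto simp: measure_pmf_single pmf_eq_0_set_pmf)
  have "first_passage_prob E u j (Suc n) =
      (\<integral>v. measure_pmf.prob (map_pmf (\<lambda>xs. v # xs) (rw_path E n v)) ?A \<partial>measure_pmf (rw_step E u))"
    unfolding first_passage_prob_def rw_path.simps measure_pmf_bind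
    by (rule measure_pmf.measure_bind[where N = "count_space UNIV"])
       (auto simp: measurable_def space_subprob_algebra intro: measure_pmf.subprob_space_axioms)
  also have "\<dots> = (\<Sum>v\<in>neighbours E u.
      measure_pmf.prob (map_pmf (\<lambda>xs. v # xs) (rw_path E n v)) ?A) / valency E u"
    unfolding rw_step_def using assms
    by (simp add: integral_pmf_of_set finite_neighbours neighbours_nonempty)
  also have "\<dots> = (\<Sum>v\<in>neighbours E u.
      if v = j then (if n = 0 then 1 else 0) else first_passage_prob E v j n) / valency E u"
    by (intro arg_cong2[where f = "(/)"] sum.cong refl)
       (simp only: measure_map_pmf vim, simp add: nil first_passage_prob_def)
  finally show ?thesis .
qed

text \<open>Probability of avoiding \<open>j\<close> at times \<open>1\<close> to \<open>n\<close>.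
  The starting vertex is not tested, so \<open>survival j 0 j = 1\<close>, in accordance with first
  passage at times \<open>t \<ge> 1\<close>.\<close>

primrec survival :: "'a \<Rightarrow> nat \<Rightarrow> 'a \<Rightarrow> real" where
  "survival j 0 u = 1"
| "survival j (Suc n) u =
     (\<Sum>v\<in>neighbours E u. if v = j then 0 else survival j n v) / valency E u"

text \<open>First passage at time \<open>Suc n\<close> means surviving \<open>n\<close> steps but
  not \<open>Suc n\<close>; both sides obey the same first-step recursion.\<close>

lemma first_passage_prob_eq_survival_diff:
  assumes "u \<in> V"
  shows "first_passage_prob E u j (Suc n) = survival j n u - survival j (Suc n) u"
  using assms
proof (induction n arbitrary: u)
  case 0
  let ?N = "neighbours E u"
  have "(\<Sum>v\<in>?N. if v = j then 1 else 0 :: real) + (\<Sum>v\<in>?N. if v = j then 0 else 1)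
      = (\<Sum>v\<in>?N. 1)"
    unfolding sum.distrib[symmetric] by (rule sum.cong) auto
  moreover have "first_passage_prob E u j (Suc 0) = (\<Sum>v\<in>?N. if v = j then 1 else 0) / valency E u"
    by (subst first_passage_prob_Suc[OF 0])
       (simp add: first_passage_prob_def cong: if_cong)
  ultimately show ?case
    using valency_pos[OF 0] by (simp add: field_simps cong: if_cong)
next
  case (Suc n)
  let ?N = "neighbours E u"
  have "first_passage_prob E u j (Suc (Suc n)) =
      (\<Sum>v\<in>?N. if v = j then 0 else first_passage_prob E v j (Suc n)) / valency E u"
    by (subst first_passage_prob_Suc[OF Suc.prems]) (simp cong: if_cong)
  also have "(\<Sum>v\<in>?N. if v = j then 0 else first_passage_prob E v j (Suc n)) =
      (\<Sum>v\<in>?N. (if v = j then 0 else survival j n v) - (if v = j then 0 else survival j (Suc n) v))"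
    using Suc.IH[OF neighbours_in_V[OF Suc.prems]] by (intro sum.cong) auto
  also have "\<dots> / valency E u = survival j (Suc n) u - survival j (Suc (Suc n)) u"
    by (simp add: sum_subtractf diff_divide_distrib)
  finally show ?case .
qed

lemma survival_nonneg: "0 \<le> survival j n u"
  by (induction n arbitrary: u) (auto intro!: sum_nonneg divide_nonneg_nonneg)

text \<open>
  At a vertex other than \<open>j\<close> a solution of the hitting-time equations exceeds the average over
  its neighbours, so its minimum is attained at \<open>j\<close>.
\<close>

lemma hitting_solution_nonneg:
  assumes "j \<in> V" "h j = 0"
    and h: "\<And>u. u \<in> V \<Longrightarrow> u \<noteq> j \<Longrightarrow> h u = 1 + (\<Sum>v\<in>neighbours E u. h v) / valency E u"
    and "u \<in> V"
  shows "0 \<le> (h u :: real)"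
proof -
  obtain w where w: "w \<in> V" "\<And>v. v \<in> V \<Longrightarrow> h w \<le> h v"
    using ex_min_if_finite[of "h ` V"] finite_V nonempty_V
    by (metis (no_types, lifting) arg_min_least arg_min_if_finite(1))
  have "w = j"
  proof (rule ccontr)
    assume "w \<noteq> j"
    have "(\<Sum>v\<in>neighbours E w. h w) \<le> (\<Sum>v\<in>neighbours E w. h v)"
      using w neighbours_in_V by (intro sum_mono) auto
    then have "h w \<le> (\<Sum>v\<in>neighbours E w. h v) / valency E w"
      using valency_pos[OF w(1)] by (simp add: field_simps)
    with h[OF w(1) \<open>w \<noteq> j\<close>] show False by simp
  qed
  then show ?thesis using w(2)[OF \<open>u \<in> V\<close>] assms(2) by simp
qed

text \<open>A solution \<open>h\<close> on the finite set \<open>V\<close> forces geometric decay of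
  \<open>survival\<close>. Hence the survival probabilities sum to \<open>h i\<close>, and summation
  by parts turns this sum into the mean of the first passage time.\<close>

theorem mean_first_passage_eq:
  assumes "j \<in> V" "h j = 0"
    and h: "\<And>u. u \<in> V \<Longrightarrow> u \<noteq> j \<Longrightarrow> h u = 1 + (\<Sum>v\<in>neighbours E u. h v) / valency E u"
    and "i \<in> V" "i \<noteq> j"
  shows "mean_first_passage E i j = h i"
proof -
  have h0: "0 \<le> h u" if "u \<in> V" for u
    using hitting_solution_nonneg[OF assms(1,2) h that] by blast
  define M where "M = Max (h ` V)"
  \<comment> \<open>Chosen so that \<open>h u - 1 \<le> \<rho> * h u\<close> whenever
    \<open>h u \<le> M\<close>: one averaging step shrinks \<open>h\<close> at least by the factor
    \<open>\<rho>\<close>.\<close>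
  define \<rho> where "\<rho> = 1 - 1 / M"
  have hM: "h u \<le> M" if "u \<in> V" for u
    using that finite_V unfolding M_def by simp
  have h1: "1 \<le> h u" if "u \<in> V" "u \<noteq> j" for u
    using h[OF that] h0 neighbours_in_V[OF that(1)] by (simp add: sum_nonneg)
  have M1: "1 \<le> M"
    using h1[OF assms(4,5)] hM[OF assms(4)] by linarith
  have \<rho>: "0 \<le> \<rho>" "\<rho> < 1"
    using M1 by (auto simp: \<rho>_def)
  have step: "(\<Sum>v\<in>neighbours E u. if v = j then 0 else \<rho> ^ n * h v) / valency E u \<le> \<rho> ^ Suc n * h u"
    if "u \<in> V" "u \<noteq> j" for u n
  proof -
    have "(\<Sum>v\<in>neighbours E u. if v = j then 0 else \<rho> ^ n * h v) = \<rho> ^ n * (\<Sum>v\<in>neighbours E u. h v)"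
      unfolding sum_distrib_left by (rule sum.cong) (auto simp: assms(2))
    then have "(\<Sum>v\<in>neighbours E u. if v = j then 0 else \<rho> ^ n * h v) / valency E u = \<rho> ^ n * (h u - 1)"
      using h[OF that] by simp
    moreover have "h u - 1 \<le> \<rho> * h u"
      using hM[OF that(1)] M1 by (simp add: \<rho>_def field_simps)
    ultimately show ?thesis
      using mult_left_mono[of "h u - 1" "\<rho> * h u" "\<rho> ^ n"] \<rho>(1) by (simp add: algebra_simps)
  qed
  have surv: "survival j n u \<le> \<rho> ^ n * h u" if "u \<in> V" "u \<noteq> j" for u n
    using that
  proof (induction n arbitrary: u)
    case 0
    then show ?case using h1 by simp
  next
    case (Suc n)
    have "survival j (Suc n) u \<le> (\<Sum>v\<in>neighbours E u. if v = j then 0 else \<rho> ^ n * h v) / valency E u"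
      using Suc.IH neighbours_in_V[OF Suc.prems(1)]
      by (auto intro!: divide_right_mono sum_mono)
    with step[OF Suc.prems, of n] show ?case by linarith
  qed
  \<comment> \<open>The error obeys the averaging recursion stopped at \<open>j\<close>, so
    \<open>step\<close> applies to it as it did to \<open>survival\<close>.\<close>
  have err: "\<bar>h u - (\<Sum>n<N. survival j n u)\<bar> \<le> \<rho> ^ N * h u" if "u \<in> V" "u \<noteq> j" for u N
    using that
  proof (induction N arbitrary: u)
    case 0
    then show ?case using h0 by simp
  next
    case (Suc N)
    let ?N = "neighbours E u"
    let ?e = "\<lambda>v. if v = j then 0 else h v - (\<Sum>n<N. survival j n v)"
    have "(\<Sum>n<N. survival j (Suc n) u)
        = (\<Sum>v\<in>?N. \<Sum>n<N. if v = j then 0 else survival j n v) / valency E u"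
      by (subst sum.swap) (simp add: sum_divide_distrib)
    moreover have "(\<Sum>v\<in>?N. ?e v)
        = (\<Sum>v\<in>?N. h v) - (\<Sum>v\<in>?N. \<Sum>n<N. if v = j then 0 else survival j n v)"
      unfolding sum_subtractf[symmetric] by (rule sum.cong) (auto simp: assms(2))
    ultimately have "h u - (\<Sum>n<Suc N. survival j n u) = (\<Sum>v\<in>?N. ?e v) / valency E u"
      using h[OF Suc.prems] by (simp only: sum.lessThan_Suc_shift) (simp add: diff_divide_distrib)
    also have "\<bar>\<dots>\<bar> \<le> (\<Sum>v\<in>?N. \<bar>?e v\<bar>) / valency E u"
      by (simp add: divide_right_mono sum_abs)
    also have "\<dots> \<le> (\<Sum>v\<in>?N. if v = j then 0 else \<rho> ^ N * h v) / valency E u"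
      using Suc.IH neighbours_in_V[OF Suc.prems(1)]
      by (intro divide_right_mono sum_mono) auto
    also have "\<dots> \<le> \<rho> ^ Suc N * h u"
      by (rule step[OF Suc.prems])
    finally show ?case .
  qed
  let ?F = "first_passage_prob E i j" and ?S = "\<lambda>n. survival j n i"
  \<comment> \<open>Summation by parts; the boundary term \<open>real N * ?S N\<close> vanishes in
    the limit by geometric decay.\<close>
  have partial: "(\<Sum>n<Suc N. real n * ?F n) = (\<Sum>n<N. ?S n) - real N * ?S N" for N
  proof (induction N)
    case (Suc N)
    have "(\<Sum>n<Suc (Suc N). real n * ?F n) = (\<Sum>n<Suc N. real n * ?F n) + real (Suc N) * ?F (Suc N)"
      by simp
    also have "\<dots> = (\<Sum>n<Suc N. ?S n) - real (Suc N) * ?S (Suc N)"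
      unfolding Suc.IH first_passage_prob_eq_survival_diff[OF assms(4)]
      by (simp del: survival.simps add: algebra_simps)
    finally show ?case .
  qed simp
  have "(\<lambda>n. \<rho> ^ n * h i) \<longlonglongrightarrow> 0"
    using LIMSEQ_power_zero[of \<rho>] \<rho> by (auto intro!: tendsto_mult_left_zero)
  then have "(\<lambda>N. h i - (\<Sum>n<N. ?S n)) \<longlonglongrightarrow> 0"
    by (rule Lim_null_comparison[rotated]) (use err[OF assms(4,5)] in auto)
  then have lim1: "(\<lambda>N. \<Sum>n<N. ?S n) \<longlonglongrightarrow> h i"
    using tendsto_diff[OF tendsto_const, of _ 0 sequentially "h i"] by fastforce
  have "(\<lambda>n. real n * \<rho> ^ n * h i) \<longlonglongrightarrow> 0"
    using powser_times_n_limit_0[of \<rho>] \<rho> by (auto intro!: tendsto_mult_left_zero)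
  then have lim2: "(\<lambda>N. real N * ?S N) \<longlonglongrightarrow> 0"
    by (rule Lim_null_comparison[rotated])
       (use surv[OF assms(4,5)] survival_nonneg in
         \<open>auto simp: abs_mult mult.assoc intro!: always_eventually mult_left_mono\<close>)
  have "(\<lambda>N. \<Sum>n<Suc N. real n * ?F n) \<longlonglongrightarrow> h i"
    unfolding partial using tendsto_diff[OF lim1 lim2] by simp
  then have "(\<lambda>n. real n * ?F n) sums h i"
    unfolding sums_def by (rule LIMSEQ_imp_Suc)
  then show ?thesis
    by (simp add: mean_first_passage_def sums_iff)
qed

lemma pmf_bind_rw_step:
  assumes "set_pmf \<pi> \<subseteq> V" "v \<in> V"
  shows "pmf (bind_pmf \<pi> (rw_step E)) v = (\<Sum>u\<in>V. pmf \<pi> u * (indicator (neighbours E u) v / valency E u))"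
proof -
  have "pmf (bind_pmf \<pi> (rw_step E)) v = (\<Sum>u\<in>V. pmf (rw_step E u) v * pmf \<pi> u)"
    unfolding pmf_bind using assms(1) finite_V
    by (subst integral_measure_pmf[of V]) (auto simp: mult.commute)
  also have "\<dots> = (\<Sum>u\<in>V. pmf \<pi> u * (indicator (neighbours E u) v / valency E u))"
    by (rule sum.cong)
       (simp_all add: rw_step_def pmf_of_set finite_neighbours neighbours_nonempty)
  finally show ?thesis .
qed

end

section \<open>Kemeny's constant from effective resistances\<close>

text \<open>
  \<open>R\<close> is a function with the defining property of the effective resistance: the graph Laplacian
  maps \<open>R(\<cdot>, y)\<close> to \<open>\<tau> - 2 \<one>\<^sub>y\<close> with \<open>\<tau>\<close> independent of \<open>y\<close>.
\<close>

locale electrical_network = finite_walk +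
  fixes R :: "'a \<Rightarrow> 'a \<Rightarrow> real" and \<tau> :: "'a \<Rightarrow> real"
  assumes R_self: "x \<in> V \<Longrightarrow> R x x = 0"
    and R_sym: "x \<in> V \<Longrightarrow> y \<in> V \<Longrightarrow> R x y = R y x"
    and R_laplace: "u \<in> V \<Longrightarrow> y \<in> V \<Longrightarrow>
      (\<Sum>v\<in>neighbours E u. R u y - R v y) = \<tau> u - (if u = y then 2 else 0)"
begin

section \<open>Hitting times and stationary distribution from resistances\<close>

definition volume :: real where
  "volume = (\<Sum>x\<in>V. valency E x)"

definition hit :: "'a \<Rightarrow> 'a \<Rightarrow> real" where
  "hit j u = (\<Sum>z\<in>V. valency E z * (R u j + R j z - R u z)) / 2"

lemma volume_pos: "volume > 0"
  unfolding volume_def using finite_V nonempty_V valency_pos by (intro sum_pos) auto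

lemma hit_self: "j \<in> V \<Longrightarrow> hit j j = 0"
  by (simp add: hit_def R_self)

text \<open>\<open>\<tau> u\<close> cancels between the terms in \<open>R u j\<close> and
  \<open>R u z\<close>. Of the point masses, the one at \<open>z = u\<close> leaves the valency, and
  the one at \<open>u = j\<close> is summed over all \<open>z\<close> into
  \<open>volume\<close>.\<close>

lemma hit_laplace:
  assumes "u \<in> V" "j \<in> V"
  shows "(\<Sum>v\<in>neighbours E u. hit j u - hit j v) = valency E u - (if u = j then volume else 0)"
proof -
  have "(\<Sum>v\<in>neighbours E u. hit j u - hit j v)
      = (\<Sum>v\<in>neighbours E u. \<Sum>z\<in>V. valency E z * ((R u j - R v j) - (R u z - R v z)) / 2)"
    unfolding hit_def sum_divide_distrib sum_subtractf[symmetric]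
    by (intro sum.cong refl) (simp add: field_simps)
  also have "\<dots> = (\<Sum>z\<in>V. \<Sum>v\<in>neighbours E u. valency E z * ((R u j - R v j) - (R u z - R v z)) / 2)"
    by (rule sum.swap)
  also have "\<dots> = (\<Sum>z\<in>V. valency E z * ((\<Sum>v\<in>neighbours E u. R u j - R v j)
      - (\<Sum>v\<in>neighbours E u. R u z - R v z)) / 2)"
    unfolding sum_subtractf[of "\<lambda>v. R u j - R v j" "\<lambda>v. R u z - R v z" for z, symmetric]
    by (simp add: sum_distrib_left sum_divide_distrib)
  also have "\<dots> = (\<Sum>z\<in>V. (if u = z then valency E z else 0) - (if u = j then valency E z else 0))"
    by (intro sum.cong refl) (simp add: R_laplace assms)
  also have "\<dots> = valency E u - (if u = j then volume else 0)"
    using assms finite_V by (simp add: sum_subtractf volume_def)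
  finally show ?thesis .
qed

text \<open>Since \<open>hit j j = 0\<close>, the case \<open>u = j\<close> identifies the mean
  return time as \<open>volume / valency E j\<close>; this is what determines the stationary
  distribution below.\<close>

lemma hit_eq:
  assumes "u \<in> V" "j \<in> V"
  shows "hit j u = 1 - (if u = j then volume / valency E u else 0)
    + (\<Sum>v\<in>neighbours E u. hit j v) / valency E u"
  using hit_laplace[OF assms] valency_pos[OF assms(1)]
  by (auto simp: sum_subtractf field_simps)

lemma mean_first_passage_eq_hit:
  assumes "i \<in> V" "j \<in> V" "i \<noteq> j"
  shows "mean_first_passage E i j = hit j i"
  using assms hit_self[of j] hit_eq[of _ j] by (intro mean_first_passage_eq) auto

text \<open>Average \<open>hit_eq\<close> against \<open>\<pi>\<close>: by stationarity the two
  averages of \<open>hit j\<close> cancel, leaving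
  \<open>1 = pmf \<pi> j * (volume / valency E j)\<close>.\<close>

lemma pmf_stationary_unique:
  assumes "set_pmf \<pi> \<subseteq> V" "bind_pmf \<pi> (rw_step E) = \<pi>" "j \<in> V"
  shows "pmf \<pi> j = valency E j / volume"
proof -
  have one: "(\<Sum>u\<in>V. pmf \<pi> u) = 1"
    using assms(1) finite_V by (simp add: sum_pmf_eq_1)
  have ind: "(\<Sum>v\<in>neighbours E u. hit j v) = (\<Sum>v\<in>V. indicator (neighbours E u) v * hit j v)"
    if "u \<in> V" for u
    using neighbours_subset[OF that] finite_V
    by (intro sum.mono_neutral_cong_left) (auto simp: indicator_def)
  have "(\<Sum>u\<in>V. pmf \<pi> u * ((\<Sum>v\<in>neighbours E u. hit j v) / valency E u))
      = (\<Sum>u\<in>V. \<Sum>v\<in>V. pmf \<pi> u * (indicator (neighbours E u) v / valency E u) * hit j v)"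
    by (intro sum.cong refl)
       (simp add: ind sum_distrib_left sum_divide_distrib mult.assoc)
  also have "\<dots> = (\<Sum>v\<in>V. \<Sum>u\<in>V. pmf \<pi> u * (indicator (neighbours E u) v / valency E u) * hit j v)"
    by (rule sum.swap)
  also have "\<dots> = (\<Sum>v\<in>V. pmf \<pi> v * hit j v)"
    by (intro sum.cong refl)
       (simp only: sum_distrib_right[symmetric] pmf_bind_rw_step[OF assms(1), symmetric] assms(2))
  finally have avg: "(\<Sum>u\<in>V. pmf \<pi> u * ((\<Sum>v\<in>neighbours E u. hit j v) / valency E u))
      = (\<Sum>v\<in>V. pmf \<pi> v * hit j v)" .
  have "(\<Sum>u\<in>V. pmf \<pi> u * hit j u) = (\<Sum>u\<in>V. pmf \<pi> u
      - (if u = j then pmf \<pi> u * (volume / valency E u) else 0)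
      + pmf \<pi> u * ((\<Sum>v\<in>neighbours E u. hit j v) / valency E u))"
  proof (intro sum.cong refl)
    fix u assume "u \<in> V"
    show "pmf \<pi> u * hit j u = pmf \<pi> u - (if u = j then pmf \<pi> u * (volume / valency E u) else 0)
      + pmf \<pi> u * ((\<Sum>v\<in>neighbours E u. hit j v) / valency E u)"
      by (subst hit_eq[OF \<open>u \<in> V\<close> assms(3)]) (simp add: algebra_simps)
  qed
  also have "\<dots> = 1 - pmf \<pi> j * (volume / valency E j) + (\<Sum>v\<in>V. pmf \<pi> v * hit j v)"
    using assms(3) finite_V unfolding sum.distrib avg by (simp add: sum_subtractf one)
  finally show ?thesis
    using valency_pos[OF assms(3)] volume_pos by (simp add: field_simps)
qed

text \<open>Weights proportional to the valency satisfy detailed balance, because adjacency is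
  symmetric.\<close>

lemma stationary_exists: "\<exists>\<pi>. set_pmf \<pi> \<subseteq> V \<and> bind_pmf \<pi> (rw_step E) = \<pi>"
proof -
  define f where "f x = (if x \<in> V then valency E x / volume else 0)" for x
  have f0: "0 \<le> f x" for x
    using volume_pos by (simp add: f_def)
  have "(\<Sum>x\<in>V. f x) = 1"
    using volume_pos by (simp add: f_def sum_divide_distrib[symmetric] volume_def[symmetric])
  moreover have "(\<integral>\<^sup>+x. ennreal (f x) \<partial>count_space UNIV) = (\<Sum>x\<in>V. ennreal (f x))"
    by (rule nn_integral_count_space'[OF finite_V]) (auto simp: f_def)
  ultimately have "(\<integral>\<^sup>+x. ennreal (f x) \<partial>count_space UNIV) = 1"
    by (simp add: sum_ennreal f0)
  then have pmf_f: "pmf (embed_pmf f) x = f x" for x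
    by (rule pmf_embed_pmf[OF f0])
  let ?\<pi> = "embed_pmf f"
  have sub: "set_pmf ?\<pi> \<subseteq> V"
    by (auto simp: set_pmf_eq pmf_f f_def split: if_splits)
  have "bind_pmf ?\<pi> (rw_step E) = ?\<pi>"
  proof (rule pmf_eqI)
    fix v
    show "pmf (bind_pmf ?\<pi> (rw_step E)) v = pmf ?\<pi> v"
    proof (cases "v \<in> V")
      case True
      have "pmf (bind_pmf ?\<pi> (rw_step E)) v = (\<Sum>u\<in>V. indicator (neighbours E v) u / volume)"
        unfolding pmf_bind_rw_step[OF sub True] using valency_pos
        by (intro sum.cong refl)
           (auto simp: pmf_f f_def indicator_def neighbours_sym[of v])
      also have "\<dots> = valency E v / volume"
        using neighbours_subset[OF True] finite_V
        by (simp add: sum_divide_distrib[symmetric] indicator_def sum.If_cases Int_absorb1)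
      finally show ?thesis using True by (simp add: pmf_f f_def)
    next
      case False
      then have "v \<notin> set_pmf (bind_pmf ?\<pi> (rw_step E))"
        using sub neighbours_subset
        by (force simp: rw_step_def finite_neighbours neighbours_nonempty)
      then have "pmf (bind_pmf ?\<pi> (rw_step E)) v = 0"
        using set_pmf_iff by fast
      then show ?thesis using False by (simp add: pmf_f f_def)
    qed
  qed
  with sub show ?thesis by blast
qed

lemma pmf_stationary_dist:
  assumes "j \<in> V"
  shows "pmf (stationary_dist V E) j = valency E j / volume"
proof -
  have "\<exists>!\<pi>. set_pmf \<pi> \<subseteq> V \<and> bind_pmf \<pi> (rw_step E) = \<pi>"
  proof (rule ex_ex1I[OF stationary_exists])
    fix \<pi> \<pi>' :: "'a pmf"
    assume *: "set_pmf \<pi> \<subseteq> V \<and> bind_pmf \<pi> (rw_step E) = \<pi>"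
      "set_pmf \<pi>' \<subseteq> V \<and> bind_pmf \<pi>' (rw_step E) = \<pi>'"
    show "\<pi> = \<pi>'"
    proof (rule pmf_eqI)
      fix x show "pmf \<pi> x = pmf \<pi>' x"
        using * pmf_stationary_unique by (cases "x \<in> V") (auto, metis set_pmf_iff subsetD)
    qed
  qed
  from theI'[OF this] show ?thesis
    unfolding stationary_dist_def using pmf_stationary_unique assms by blast
qed

text \<open>In the stationary average of \<open>hit j i\<close> the two sums containing
  \<open>R i\<close> coincide after exchanging \<open>j\<close> and \<open>z\<close> and cancel, so
  what remains does not depend on \<open>i\<close>.\<close>

theorem kemeny_eq:
  "kemeny V E = (\<Sum>x\<in>V. valency E x * (\<Sum>y\<in>V. valency E y * R x y)) / (2 * volume)"
    (is "_ = ?K")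
proof -
  have "(\<Sum>j\<in>V - {i}. mean_first_passage E i j * pmf (stationary_dist V E) j) = ?K"
    if i: "i \<in> V" for i
  proof -
    have "(\<Sum>j\<in>V - {i}. mean_first_passage E i j * pmf (stationary_dist V E) j)
        = (\<Sum>j\<in>V - {i}. hit j i * (valency E j / volume))"
      by (intro sum.cong refl) (auto simp: mean_first_passage_eq_hit[OF i] pmf_stationary_dist)
    also have "\<dots> = (\<Sum>j\<in>V. hit j i * (valency E j / volume))"
      using i finite_V by (simp add: sum_diff1 hit_self)
    also have "\<dots> = (\<Sum>j\<in>V. \<Sum>z\<in>V. valency E z * (valency E j * R i j)) / (2 * volume)
        + (\<Sum>j\<in>V. \<Sum>z\<in>V. valency E j * (valency E z * R j z)) / (2 * volume)
        - (\<Sum>j\<in>V. \<Sum>z\<in>V. valency E j * (valency E z * R i z)) / (2 * volume)"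
      unfolding hit_def sum_divide_distrib sum_distrib_right sum.distrib[symmetric]
        sum_subtractf[symmetric]
      by (intro sum.cong refl) (simp add: algebra_simps add_divide_distrib diff_divide_distrib)
    also have "(\<Sum>j\<in>V. \<Sum>z\<in>V. valency E z * (valency E j * R i j))
        = (\<Sum>j\<in>V. \<Sum>z\<in>V. valency E j * (valency E z * R i z))"
      by (rule sum.swap)
    finally show ?thesis by (simp add: sum_distrib_left)
  qed
  \<comment> \<open>A vertex must exist for \<open>THE\<close> to single out the value.\<close>
  then show ?thesis
    unfolding kemeny_def using nonempty_V by (intro the_equality) auto
qed

section \<open>Effect of adding one edge\<close>

context
  fixes a b :: 'a
  assumes ab: "a \<in> V" "b \<in> V" "a \<noteq> b" "{a, b} \<notin> E" "R a b \<noteq> - 1"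
begin

lemma neighbours_insert_edge:
  "neighbours (insert {a, b} E) u =
    (if u = a then insert b (neighbours E a) else if u = b then insert a (neighbours E b)
     else neighbours E u)"
  using ab by (auto simp: neighbours_def doubleton_eq_iff)

lemma sum_neighbours_insert_edge:
  fixes f :: "'a \<Rightarrow> 'c::comm_monoid_add"
  assumes "u \<in> V"
  shows "(\<Sum>v\<in>neighbours (insert {a, b} E) u. f v) =
    (\<Sum>v\<in>neighbours E u. f v) + (if u = a then f b else 0) + (if u = b then f a else 0)"
proof -
  have "b \<notin> neighbours E a" "a \<notin> neighbours E b"
    using ab by (auto simp: neighbours_def insert_commute)
  then show ?thesis
    using ab finite_neighbours by (auto simp: neighbours_insert_edge add.commute)
qed

lemma valency_insert_edge:
  assumes "u \<in> V"
  shows "valency (insert {a, b} E) u = valency E u + (if u = a then 1 else 0) + (if u = b then 1 else 0)"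
  using sum_neighbours_insert_edge[OF assms, of "\<lambda>_. 1 :: real"] by simp

lemma sum_valency_insert_edge:
  "(\<Sum>x\<in>V. valency (insert {a, b} E) x * f x) = (\<Sum>x\<in>V. valency E x * f x) + f a + f b"
proof -
  have "(\<Sum>x\<in>V. valency (insert {a, b} E) x * f x)
     = (\<Sum>x\<in>V. valency E x * f x + (if x = a then f x else 0) + (if x = b then f x else 0))"
    by (intro sum.cong refl) (auto simp: valency_insert_edge algebra_simps)
  then show ?thesis using ab finite_V by (simp add: sum.distrib)
qed

text \<open>
  Adding a unit conductance is a rank-one update of the Laplacian; \<open>2 g\<close> is, up to a constant,
  the difference of the potentials \<open>R(\<cdot>, a)\<close> and \<open>R(\<cdot>, b)\<close>.
\<close>

lemma electrical_network_insert_edge: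
  assumes g: "\<And>x. x \<in> V \<Longrightarrow> 2 * g x = R x a - R x b + C"
  shows "electrical_network V (insert {a, b} E) (\<lambda>x y. R x y - (g x - g y)\<^sup>2 / (1 + R a b))
    (\<lambda>u. \<tau> u - ((\<Sum>v\<in>neighbours E u. (g u)\<^sup>2 - (g v)\<^sup>2)
        + C * ((if u = a then 1 else 0) - (if u = b then 1 else 0))) / (1 + R a b))"
proof
  fix u y assume u: "u \<in> V" and y: "y \<in> V"
  define \<rho> where "\<rho> = 1 + R a b"
  have \<rho>: "\<rho> \<noteq> 0" using ab(5) by (simp add: \<rho>_def add_eq_0_iff)
  let ?N = "neighbours E u"
  let ?ia = "if u = a then 1 else 0 :: real" and ?ib = "if u = b then 1 else 0 :: real"
  let ?R' = "\<lambda>x y. R x y - (g x - g y)\<^sup>2 / \<rho>"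
  \<comment> \<open>Here \<open>\<tau>\<close> cancels, leaving opposite point masses at
    \<open>a\<close> and \<open>b\<close>.\<close>
  have Lg: "(\<Sum>v\<in>?N. g u - g v) = ?ib - ?ia"
  proof -
    have "2 * (\<Sum>v\<in>?N. g u - g v) = (\<Sum>v\<in>?N. (R u a - R v a) - (R u b - R v b))"
      unfolding sum_distrib_left
      by (intro sum.cong refl)
         (use g[OF u] g neighbours_in_V[OF u] in \<open>fastforce simp: algebra_simps\<close>)
    also have "\<dots> = 2 * (?ib - ?ia)"
      by (subst sum_subtractf) (simp add: R_laplace u ab)
    finally show ?thesis by simp
  qed
  have gab: "g b - g a = R a b"
    using g[OF ab(1)] g[OF ab(2)] R_sym[OF ab(1,2)] R_self ab by simp
  have gC: "g a + g b = C"
    using g[OF ab(1)] g[OF ab(2)] R_sym[OF ab(1,2)] R_self ab by simp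
  have Ry: "R a y - R b y = 2 * g y - C"
    using g[OF y] R_sym[OF ab(1) y] R_sym[OF ab(2) y] by simp
  have "(\<Sum>v\<in>neighbours (insert {a, b} E) u. ?R' u y - ?R' v y)
      = (\<Sum>v\<in>?N. ?R' u y - ?R' v y) + ?ia * (?R' a y - ?R' b y) + ?ib * (?R' b y - ?R' a y)"
    by (subst sum_neighbours_insert_edge[OF u]) auto
  \<comment> \<open>Expanding the squares, \<open>y\<close> enters the correction only through
    \<open>2 * g y * (g u - g v)\<close>; the contribution of the new edge will cancel this
    dependence on \<open>y\<close>.\<close>
  also have "(\<Sum>v\<in>?N. ?R' u y - ?R' v y)
      = (\<Sum>v\<in>?N. (R u y - R v y) - ((g u)\<^sup>2 - (g v)\<^sup>2) / \<rho> + 2 * g y * (g u - g v) / \<rho>)"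
    using \<rho> by (intro sum.cong refl) (simp add: field_simps power2_eq_square)
  also have "\<dots> = (\<Sum>v\<in>?N. R u y - R v y) - (\<Sum>v\<in>?N. (g u)\<^sup>2 - (g v)\<^sup>2) / \<rho>
      + 2 * g y * (\<Sum>v\<in>?N. g u - g v) / \<rho>"
    by (simp only: sum.distrib sum_subtractf[of "\<lambda>v. R u y - R v y"] sum_divide_distrib sum_distrib_left)
  finally have sum_eq: "(\<Sum>v\<in>neighbours (insert {a, b} E) u. ?R' u y - ?R' v y) =
      (\<Sum>v\<in>?N. R u y - R v y) - (\<Sum>v\<in>?N. (g u)\<^sup>2 - (g v)\<^sup>2) / \<rho>
      + 2 * g y * (\<Sum>v\<in>?N. g u - g v) / \<rho>
      + ?ia * (?R' a y - ?R' b y) + ?ib * (?R' b y - ?R' a y)" .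
  have "(g a - g y)\<^sup>2 - (g b - g y)\<^sup>2 = (g a - g b) * (g a + g b - 2 * g y)"
    by (simp add: power2_eq_square algebra_simps)
  also have "\<dots> = (\<rho> - 1) * (2 * g y - C)"
    using gab gC by (simp add: \<rho>_def algebra_simps)
  finally have "(g a - g y)\<^sup>2 / \<rho> - (g b - g y)\<^sup>2 / \<rho> = (\<rho> - 1) * (2 * g y - C) / \<rho>"
    by (simp only: diff_divide_distrib[symmetric])
  then have "?R' a y - ?R' b y = (2 * g y - C) - (\<rho> - 1) * (2 * g y - C) / \<rho>"
    using Ry by linarith
  also have "\<dots> = (2 * g y - C) / \<rho>"
    using \<rho> by (simp add: field_simps)
  finally have R'ab: "?R' a y - ?R' b y = (2 * g y - C) / \<rho>" .
  then have R'ba: "?R' b y - ?R' a y = - ((2 * g y - C) / \<rho>)"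
    by linarith
  show "(\<Sum>v\<in>neighbours (insert {a, b} E) u.
        R u y - (g u - g y)\<^sup>2 / (1 + R a b) - (R v y - (g v - g y)\<^sup>2 / (1 + R a b))) =
      \<tau> u - ((\<Sum>v\<in>neighbours E u. (g u)\<^sup>2 - (g v)\<^sup>2)
        + C * ((if u = a then 1 else 0) - (if u = b then 1 else 0))) / (1 + R a b)
      - (if u = y then 2 else 0)"
    unfolding \<rho>_def[symmetric] sum_eq R'ab R'ba Lg R_laplace[OF u y]
    using \<rho> by (simp add: field_simps)
next
qed (use finite_V nonempty_V ab neighbours_in_V neighbours_nonempty in
  \<open>auto simp: neighbours_insert_edge R_self R_sym power2_commute split: if_splits\<close>)

text \<open>Apply \<open>kemeny_eq\<close> to the updated network. With total weight
  \<open>W = volume + 2\<close>, the weighted double sum of \<open>(g x - g y)^2\<close> is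
  \<open>2 * W\<close> times the weighted sum of squares minus twice the square of the weighted sum;
  passing to the new valencies adds the values at \<open>a\<close> and \<open>b\<close>.\<close>

theorem kemeny_insert_edge:
  assumes g: "\<And>x. x \<in> V \<Longrightarrow> 2 * g x = R x a - R x b + C"
  shows "kemeny V (insert {a, b} E) =
    ((\<Sum>x\<in>V. valency E x * (\<Sum>y\<in>V. valency E y * R x y))
      + 2 * ((\<Sum>x\<in>V. valency E x * R x a) + (\<Sum>x\<in>V. valency E x * R x b) + R a b)
      - (2 * (volume + 2) * ((\<Sum>x\<in>V. valency E x * (g x)\<^sup>2) + (g a)\<^sup>2 + (g b)\<^sup>2)
          - 2 * ((\<Sum>x\<in>V. valency E x * g x) + g a + g b)\<^sup>2) / (1 + R a b))
    / (2 * (volume + 2))"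
proof -
  let ?E = "insert {a, b} E" and ?R = "\<lambda>x y. R x y - (g x - g y)\<^sup>2 / (1 + R a b)"
  let ?D = "\<lambda>f. \<Sum>x\<in>V. valency ?E x * f x"
  interpret N': electrical_network V ?E ?R "\<lambda>u. \<tau> u - ((\<Sum>v\<in>neighbours E u. (g u)\<^sup>2 - (g v)\<^sup>2)
        + C * ((if u = a then 1 else 0) - (if u = b then 1 else 0))) / (1 + R a b)"
    by (rule electrical_network_insert_edge[OF g])
  have vol: "?D (\<lambda>_. 1) = volume + 2"
    unfolding sum_valency_insert_edge by (simp add: volume_def)
  then have vol': "N'.volume = volume + 2"
    by (simp add: N'.volume_def)
  have sym: "(\<Sum>x\<in>V. valency E x * R c x) = (\<Sum>x\<in>V. valency E x * R x c)" if "c \<in> V" for c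
    using R_sym that by (intro sum.cong) auto
  have RR: "?D (\<lambda>x. ?D (\<lambda>y. R x y)) = (\<Sum>x\<in>V. valency E x * (\<Sum>y\<in>V. valency E y * R x y))
      + 2 * ((\<Sum>x\<in>V. valency E x * R x a) + (\<Sum>x\<in>V. valency E x * R x b) + R a b)"
    unfolding sum_valency_insert_edge
    using ab R_self R_sym[OF ab(1,2)] by (simp add: sym distrib_left sum.distrib)
  have "?D (\<lambda>y. (g x - g y)\<^sup>2) = (g x)\<^sup>2 * ?D (\<lambda>_. 1) - 2 * g x * ?D g + ?D (\<lambda>y. (g y)\<^sup>2)" for x
    unfolding sum_distrib_left sum_subtractf[symmetric] sum.distrib[symmetric]
    by (intro sum.cong refl) (simp add: power2_eq_square algebra_simps)
  moreover have lin: "?D (\<lambda>x. (g x)\<^sup>2 * s - 2 * g x * t + c)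
      = ?D (\<lambda>x. (g x)\<^sup>2) * s - 2 * ?D g * t + c * ?D (\<lambda>_. 1)" for s t c
    unfolding sum_distrib_left sum_distrib_right sum_subtractf[symmetric] sum.distrib[symmetric]
    by (intro sum.cong refl) (simp add: algebra_simps)
  ultimately have "?D (\<lambda>x. ?D (\<lambda>y. (g x - g y)\<^sup>2))
      = ?D (\<lambda>x. (g x)\<^sup>2 * (volume + 2) - 2 * g x * ?D g + ?D (\<lambda>y. (g y)\<^sup>2))"
    by (simp only: vol)
  also have "\<dots> = ?D (\<lambda>x. (g x)\<^sup>2) * (volume + 2) - 2 * ?D g * ?D g
      + ?D (\<lambda>y. (g y)\<^sup>2) * ?D (\<lambda>_. 1)"
    by (rule lin)
  finally have gg: "?D (\<lambda>x. ?D (\<lambda>y. (g x - g y)\<^sup>2))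
      = 2 * (volume + 2) * ?D (\<lambda>x. (g x)\<^sup>2) - 2 * (?D g)\<^sup>2"
    unfolding vol by algebra
  have "?D (\<lambda>x. ?D (?R x)) = ?D (\<lambda>x. ?D (\<lambda>y. R x y)) - ?D (\<lambda>x. ?D (\<lambda>y. (g x - g y)\<^sup>2)) / (1 + R a b)"
    unfolding sum_distrib_left sum_divide_distrib sum_subtractf[symmetric]
    by (intro sum.cong refl) (simp add: right_diff_distrib)
  then show ?thesis
    unfolding N'.kemeny_eq vol' RR gg unfolding sum_valency_insert_edge by (simp add: algebra_simps)
qed

end

end

section \<open>The broom as an electrical network\<close>

text \<open>Graph distance of the broom: \<open>min x (Suc k)\<close> puts every leaf at position
  \<open>k + 1\<close> of a line, which gives the right distance except between two leaves.\<close>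

definition broom_dist :: "nat \<Rightarrow> nat \<Rightarrow> nat \<Rightarrow> real" where
  "broom_dist k x y = (if x = y then 0 else if k < x \<and> k < y then 2
     else \<bar>real (min x (Suc k)) - real (min y (Suc k))\<bar>)"

lemma broom_dist_sym: "broom_dist k x y = broom_dist k y x"
  by (auto simp: broom_dist_def)

lemma broom_dist_path: "s \<le> k \<Longrightarrow> t \<le> Suc k \<Longrightarrow> broom_dist k s t = \<bar>real s - real t\<bar>"
  by (auto simp: broom_dist_def)

lemma broom_dist_path_leaf: "s \<le> k \<Longrightarrow> k < y \<Longrightarrow> broom_dist k s y = real k + 1 - real s"
  by (auto simp: broom_dist_def)

lemma broom_dist_leaf_path: "s \<le> k \<Longrightarrow> k < y \<Longrightarrow> broom_dist k y s = real k + 1 - real s"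
  by (auto simp: broom_dist_def)

lemma broom_dist_leaf_leaf: "k < x \<Longrightarrow> k < y \<Longrightarrow> broom_dist k x y = (if x = y then 0 else 2)"
  by (auto simp: broom_dist_def)

locale broom =
  fixes k p :: nat
  assumes k3: "3 \<le> k"
begin

abbreviation "V \<equiv> broom_verts k p"
abbreviation "E \<equiv> broom_edges k p"
abbreviation "L \<equiv> broom_leaves k p"

section \<open>Neighbourhoods and valencies in the broom\<close>

lemma V_cases:
  assumes "u \<in> V"
  obtains "u = 1" | "1 < u" "u < k" | "u = k" | "u \<in> L"
  using assms by (fastforce simp: broom_verts_def broom_path_def)

lemma mem_edges: "{x, y} \<in> E \<longleftrightarrow> (1 \<le> x \<and> x < k \<and> y = Suc x) \<or> (1 \<le> y \<and> y < k \<and> x = Suc y)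
    \<or> (x = k \<and> y \<in> L) \<or> (y = k \<and> x \<in> L)"
  by (auto simp: broom_edges_def doubleton_eq_iff)

lemma neighbours_end: "neighbours E 1 = {2}"
  using k3 by (auto simp: neighbours_def mem_edges broom_leaves_def)

lemma neighbours_inner: "1 < u \<Longrightarrow> u < k \<Longrightarrow> neighbours E u = {u - 1, u + 1}"
  by (auto simp: neighbours_def mem_edges broom_leaves_def)

lemma neighbours_centre: "neighbours E k = insert (k - 1) L"
  using k3 by (auto simp: neighbours_def mem_edges broom_leaves_def)

lemma neighbours_leaf: "u \<in> L \<Longrightarrow> neighbours E u = {k}"
  by (auto simp: neighbours_def mem_edges broom_leaves_def)

lemma finite_L: "finite L" and card_L: "card L = p" and L_gt: "y \<in> L \<Longrightarrow> k < y"
  by (auto simp: broom_leaves_def)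

lemma pred_k_notin_L: "k - 1 \<notin> L"
  using L_gt[of "k - 1"] by auto

lemma valency_path: "1 \<le> t \<Longrightarrow> t \<le> k \<Longrightarrow>
    valency E t = (if t < k then 1 else 0) + (if 1 < t then 1 else 0) + (if t = k then real p else 0)"
  using k3 neighbours_end neighbours_inner[of t] neighbours_centre finite_L card_L pred_k_notin_L
  by (cases "t = 1"; cases "t = k") auto

lemma valency_leaf: "u \<in> L \<Longrightarrow> valency E u = 1"
  by (simp add: neighbours_leaf)

text \<open>Summation over edges: every edge contributes the values of \<open>f\<close> at both its
  ends.\<close>

lemma sum_valency:
  "(\<Sum>x\<in>V. valency E x * f x) =
    (\<Sum>t\<in>{1..<k}. f t + f (t + 1)) + real p * f k + (\<Sum>x\<in>L. f x)"
proof -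
  have fst: "(\<Sum>t\<in>{1..k}. if t < k then f t else 0) = (\<Sum>t\<in>{1..<k}. f t)"
    by (rule sum.mono_neutral_cong_right) auto
  have "(\<Sum>t\<in>{1..k}. if 1 < t then f t else 0) = (\<Sum>t\<in>{Suc 1..<Suc k}. f t)"
    by (rule sum.mono_neutral_cong_right) auto
  also have "\<dots> = (\<Sum>t\<in>{1..<k}. f (t + 1))"
    by (subst sum.shift_bounds_Suc_ivl) simp
  finally have snd: "(\<Sum>t\<in>{1..k}. if 1 < t then f t else 0) = (\<Sum>t\<in>{1..<k}. f (t + 1))" .
  have "(\<Sum>x\<in>V. valency E x * f x) = (\<Sum>x\<in>{1..k}. valency E x * f x) + (\<Sum>x\<in>L. valency E x * f x)"
    unfolding broom_verts_def broom_path_def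
    by (rule sum.union_disjoint) (auto simp: broom_leaves_def)
  also have "(\<Sum>x\<in>{1..k}. valency E x * f x) = (\<Sum>t\<in>{1..k}. (if t < k then f t else 0)
      + (if 1 < t then f t else 0) + (if t = k then real p * f t else 0))"
    by (intro sum.cong refl) (auto simp: valency_path distrib_right)
  also have "\<dots> = (\<Sum>t\<in>{1..<k}. f t) + (\<Sum>t\<in>{1..<k}. f (t + 1)) + real p * f k"
    using k3 by (simp only: sum.distrib fst snd) simp
  also have "(\<Sum>x\<in>L. valency E x * f x) = (\<Sum>x\<in>L. f x)"
    by (intro sum.cong refl) (simp add: valency_leaf)
  finally show ?thesis by (simp add: sum.distrib)
qed

text \<open>On a tree every vertex other than \<open>y\<close> has exactly one neighbour closer to \<open>y\<close>.\<close>

sublocale electrical_network V E "broom_dist k" "\<lambda>u. 2 - valency E u"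
proof
  show "finite V" "V \<noteq> {}"
    using k3 by (auto simp: broom_verts_def broom_path_def broom_leaves_def)
next
  fix u assume u: "u \<in> V"
  show "neighbours E u \<subseteq> V" "neighbours E u \<noteq> {}"
    using u k3 by (cases rule: V_cases; auto simp: neighbours_end[simplified] neighbours_inner
        neighbours_centre neighbours_leaf broom_verts_def broom_path_def)+
next
  fix u y assume u: "u \<in> V" and y: "y \<in> V"
  have y1: "1 \<le> y" using y by (auto simp: broom_verts_def broom_path_def broom_leaves_def)
  from u show "(\<Sum>v\<in>neighbours E u. broom_dist k u y - broom_dist k v y)
      = 2 - valency E u - (if u = y then 2 else 0)"
  proof (cases rule: V_cases)
    case 1
    then show ?thesis
      using k3 y1 by (simp add: neighbours_end[simplified]) (auto simp: broom_dist_def)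
  next
    case 2
    then show ?thesis
      using k3
      by (cases u y rule: linorder_cases)
         (auto simp: neighbours_inner broom_dist_def of_nat_diff min_def)
  next
    case 3
    have sum_L: "(\<Sum>v\<in>L. broom_dist k k y - broom_dist k v y)
        = (if y \<in> L then 2 - real p else - real p)"
    proof (cases "y \<in> L")
      case True
      have "(\<Sum>v\<in>L. broom_dist k k y - broom_dist k v y) = (\<Sum>v\<in>L. - 1 + (if v = y then 2 else 0))"
        using True L_gt
        by (intro sum.cong refl) (auto simp: broom_dist_path_leaf broom_dist_leaf_leaf)
      then show ?thesis
        using True finite_L card_L by (simp add: sum_subtractf)
    next
      case False
      then have "y \<le> k" using y by (auto simp: broom_verts_def broom_path_def)
      then have "(\<Sum>v\<in>L. broom_dist k k y - broom_dist k v y) = (\<Sum>v\<in>L. - 1)"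
        using L_gt
        by (intro sum.cong refl) (auto simp: broom_dist_path broom_dist_leaf_path)
      then show ?thesis using False card_L by simp
    qed
    have "broom_dist k k y - broom_dist k (k - 1) y = (if y = k \<or> y \<in> L then - 1 else 1)"
      using y k3 by (auto simp: broom_verts_def broom_path_def broom_leaves_def broom_dist_def of_nat_diff)
    then show ?thesis
      using 3 sum_L finite_L card_L pred_k_notin_L L_gt[of k] by (auto simp: neighbours_centre)
  next
    case 4
    then show ?thesis
      using k3 y by (auto simp: neighbours_leaf broom_dist_def broom_verts_def broom_path_def
          broom_leaves_def min_def)
  qed
qed (auto simp: broom_dist_def)

end

section \<open>Comparison of Kemeny's constants\<close>

text \<open>\<open>c\<close> stands for the distance from the path end of the new edge to the
  centre, a positive integer, \<open>m\<close> for the number of edges, \<open>S\<close> and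
  \<open>T\<close> for the distance sums, \<open>A\<close> and \<open>B\<close> for the weighted
  sums of \<open>g\<close> and \<open>g^2\<close>, as in \<open>kemeny_insert_le\<close>.\<close>

lemma broom_inequality:
  fixes c k p :: real
  assumes c: "c = 1 \<or> 2 \<le> c" and "c + 1 \<le> k" "3 \<le> k" "k \<le> p"
    and S: "3 * S = 2 * (k - 1) * (2 * (k - 1)\<^sup>2 + 1) + 6 * p * k * (k - 1)
      + 3 * p * ((k - 1)\<^sup>2 + p) + 3 * p * (k\<^sup>2 + 3 * p - 3)"
    and T: "T = (k - c - 1)\<^sup>2 + c\<^sup>2 + p * (2 * c + 1) + (k\<^sup>2 + 3 * p - 3) + (c + 1)"
    and A: "A = c\<^sup>2 + c + 2 + 2 * p * c"
    and B: "3 * B = c * (c - 1) * (2 * c - 1) + 6 * p * c\<^sup>2 + 6 * (c + 1)\<^sup>2"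
    and m: "m = k - 1 + p"
  shows "(S + 2 * T - (4 * (m + 1) * B - 2 * A\<^sup>2) / (c + 2)) / (4 * (m + 1)) \<le> S / (4 * m)"
proof -
  \<comment> \<open>The claim amounts to \<open>m * (2 * T - W) \<le> S\<close> with
    \<open>W\<close> as below; multiplying the difference by \<open>3 * (c + 2)\<close> clears all
    denominators.\<close>
  define P where "P = (c + 2) * (3 * S - 6 * m * T) + m * (4 * (m + 1) * (3 * B) - 6 * A\<^sup>2)"
  define q where "q = p - k"
  have p: "p = k + q" and q: "0 \<le> q" using assms by (auto simp: q_def)
  have "0 \<le> P"
    using c
  proof
    assume c: "c = 1"
    \<comment> \<open>With \<open>c = 1\<close> the bound \<open>3 \<le> k\<close> is stronger than
      \<open>c + 1 \<le> k\<close>, and it matters: \<open>P\<close> is \<open>-18\<close> at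
      \<open>k = p = 2\<close>.\<close>
    define r where "r = k - 3"
    have k: "k = 3 + r" and r: "0 \<le> r" using assms by (auto simp: r_def)
    have "P = 546 + 138 * q + 852 * r + 288 * r * q + 24 * r * q ^ 2 + 312 * r ^ 2 + 72 * r ^ 2 * q
        + 24 * r ^ 3"
      unfolding P_def S T A B m p k c by (simp add: algebra_simps power_numeral_reduce)
    then show ?thesis using r q by simp
  next
    assume c2: "2 \<le> c"
    define d where "d = c - 2"
    define r where "r = k - c - 1"
    have c: "c = 2 + d" and d: "0 \<le> d" using c2 by (auto simp: d_def)
    have k: "k = 3 + d + r" and r: "0 \<le> r" using assms by (auto simp: r_def d_def)
    have "P = 768 + 192 * q + 2912 * r + 1056 * r * q + 96 * r * q ^ 2 + 1440 * r ^ 2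
        + 288 * r ^ 2 * q + 160 * r ^ 3 + 2144 * d + 752 * d * q + 64 * d * q ^ 2 + 5064 * d * r
        + 1504 * d * r * q + 96 * d * r * q ^ 2 + 1936 * d * r ^ 2 + 288 * d * r ^ 2 * q
        + 184 * d * r ^ 3 + 2184 * d ^ 2 + 688 * d ^ 2 * q + 48 * d ^ 2 * q ^ 2
        + 3296 * d ^ 2 * r + 696 * d ^ 2 * r * q + 24 * d ^ 2 * r * q ^ 2 + 864 * d ^ 2 * r ^ 2
        + 72 * d ^ 2 * r ^ 2 * q + 48 * d ^ 2 * r ^ 3 + 1040 * d ^ 3 + 232 * d ^ 3 * q
        + 8 * d ^ 3 * q ^ 2 + 944 * d ^ 3 * r + 104 * d ^ 3 * r * q + 128 * d ^ 3 * r ^ 2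
        + 234 * d ^ 4 + 26 * d ^ 4 * q + 100 * d ^ 4 * r + 20 * d ^ 5"
      unfolding P_def S T A B m p k c by (simp add: algebra_simps power_numeral_reduce)
    then show ?thesis using d r q by simp
  qed
  have pos: "0 < m" "0 < c + 2" using assms by auto
  define W where "W = (4 * (m + 1) * B - 2 * A\<^sup>2) / (c + 2)"
  have "W * (c + 2) = 4 * (m + 1) * B - 2 * A\<^sup>2"
    using pos by (simp add: W_def)
  then have "P = (c + 2) * (3 * (S - m * (2 * T - W)))"
    unfolding P_def by algebra
  with \<open>0 \<le> P\<close> have "m * (2 * T - W) \<le> S"
    using pos by (simp add: zero_le_mult_iff)
  then have "(S + 2 * T - W) / (4 * (m + 1)) \<le> S / (4 * m)"
    using pos by (simp add: divide_le_eq le_divide_eq) (simp add: field_simps)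
  then show ?thesis unfolding W_def .
qed

text \<open>The summand equals \<open>(t - s)^2 - (t - s - 1)^2\<close>, so the sum
  telescopes.\<close>

lemma sum_abs_below:
  assumes "1 \<le> n" "n \<le> t"
  shows "(\<Sum>s\<in>{1..<n}. \<bar>real s - real t\<bar> + \<bar>real (s + 1) - real t\<bar>)
    = (real t - 1)\<^sup>2 - (real t - real n)\<^sup>2"
  using assms
proof (induction n rule: dec_induct)
  case (step n)
  then have "\<bar>real n - real t\<bar> + \<bar>real (n + 1) - real t\<bar> = 2 * real t - 2 * real n - 1"
    by auto
  with step show ?case by (simp add: power2_eq_square algebra_simps)
qed simp

text \<open>From \<open>t\<close> on the summand becomes \<open>(s + 1 - t)^2 - (s - t)^2\<close>;
  the induction starts at \<open>n = t\<close>, where \<open>sum_abs_below\<close> applies.\<close>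

lemma sum_abs_path:
  assumes "1 \<le> t" "t \<le> n"
  shows "(\<Sum>s\<in>{1..<n}. \<bar>real s - real t\<bar> + \<bar>real (s + 1) - real t\<bar>)
    = (real t - 1)\<^sup>2 + (real n - real t)\<^sup>2"
  using assms(2)
proof (induction n rule: dec_induct)
  case base
  show ?case using sum_abs_below[OF assms(1) order_refl] by simp
next
  case (step n)
  then have "\<bar>real n - real t\<bar> + \<bar>real (n + 1) - real t\<bar> = 2 * real n - 2 * real t + 1"
    by auto
  with step assms show ?case by (simp add: power2_eq_square algebra_simps)
qed

section \<open>Distance sums of the broom and the effect of the new edge\<close>

context broom
begin

lemma volume_broom: "volume = 2 * (real k - 1 + real p)"
  using sum_valency[of "\<lambda>_. 1"] k3 card_L by (simp add: volume_def of_nat_diff)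

lemma sum_dist_path:
  assumes "1 \<le> t" "t \<le> k"
  shows "(\<Sum>x\<in>V. valency E x * broom_dist k x t)
    = (real t - 1)\<^sup>2 + (real k - real t)\<^sup>2 + real p * (2 * (real k - real t) + 1)"
proof -
  have "(\<Sum>s\<in>{1..<k}. broom_dist k s t + broom_dist k (s + 1) t)
      = (\<Sum>s\<in>{1..<k}. \<bar>real s - real t\<bar> + \<bar>real (s + 1) - real t\<bar>)"
    using assms by (intro sum.cong refl) (auto simp: broom_dist_path)
  moreover have "(\<Sum>x\<in>L. broom_dist k x t) = (\<Sum>x\<in>L. real k + 1 - real t)"
    using assms L_gt by (intro sum.cong refl) (simp add: broom_dist_leaf_path)
  moreover have "broom_dist k k t = real k - real t"
    using assms by (simp add: broom_dist_path)
  ultimately show ?thesis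
    by (simp only: sum_valency sum_abs_path[OF assms] sum_constant card_L) (simp add: algebra_simps)
qed

text \<open>A leaf lies at position \<open>k + 1\<close>: the path edges contribute
  \<open>k^2 - 1\<close>, the leaf edges \<open>p\<close> at the centre and
  \<open>2 * (p - 1)\<close> at the leaves.\<close>

lemma sum_dist_leaf:
  assumes "y \<in> L"
  shows "(\<Sum>x\<in>V. valency E x * broom_dist k x y) = (real k)\<^sup>2 + 3 * real p - 3"
proof -
  have "(\<Sum>s\<in>{1..<k}. broom_dist k s y + broom_dist k (s + 1) y)
      = (\<Sum>s\<in>{1..<k}. \<bar>real s - real (Suc k)\<bar> + \<bar>real (s + 1) - real (Suc k)\<bar>)"
    using L_gt[OF assms] by (intro sum.cong refl) (auto simp: broom_dist_path_leaf)
  moreover have "(\<Sum>x\<in>L. broom_dist k x y) = (\<Sum>x\<in>L. 2 - (if x = y then 2 else 0))"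
    using assms L_gt by (intro sum.cong refl) (auto simp: broom_dist_leaf_leaf)
  moreover have "broom_dist k k y = 1"
    using L_gt[OF assms] by (simp add: broom_dist_path_leaf)
  ultimately show ?thesis
    unfolding sum_valency using sum_abs_below[of k "Suc k"] k3 card_L finite_L assms
    by (simp add: sum_subtractf)
qed

lemma sum_dist_dist:
  "3 * (\<Sum>x\<in>V. valency E x * (\<Sum>y\<in>V. valency E y * broom_dist k x y))
    = 2 * (real k - 1) * (2 * (real k - 1)\<^sup>2 + 1) + 6 * real p * real k * (real k - 1)
      + 3 * real p * ((real k - 1)\<^sup>2 + real p) + 3 * real p * ((real k)\<^sup>2 + 3 * real p - 3)"
proof -
  define \<mu> where "\<mu> t = (real t - 1)\<^sup>2 + (real k - real t)\<^sup>2 + real p * (2 * (real k - real t) + 1)" for t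
  \<comment> \<open>\<open>k\<close> stays fixed inside \<open>\<mu>\<close> while the upper limit
    \<open>n\<close> varies, so that induction applies; the instance \<open>n = k\<close> is the one
    used.\<close>
  have path: "3 * (\<Sum>t\<in>{1..<n}. \<mu> t + \<mu> (t + 1))
      = (real n - 1) * (2 * (real n - 1)\<^sup>2 + 1) + (real k - 1) * (2 * (real k - 1)\<^sup>2 + 1)
        - (real k - real n) * (2 * (real k - real n)\<^sup>2 + 1)
        + 6 * real p * (real n - 1) * (2 * real k - real n)"
    if "1 \<le> n" for n
    using that
  proof (induction n rule: dec_induct)
    case (step n)
    then show ?case
      by (simp add: \<mu>_def) (simp add: algebra_simps power_numeral_reduce)
  qed simp
  have \<mu>: "(\<Sum>y\<in>V. valency E y * broom_dist k t y) = \<mu> t" if "1 \<le> t" "t \<le> k" for t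
    using sum_dist_path[OF that] by (simp add: \<mu>_def broom_dist_sym[of k t])
  have "(\<Sum>x\<in>L. \<Sum>y\<in>V. valency E y * broom_dist k x y) = (\<Sum>x\<in>L. (real k)\<^sup>2 + 3 * real p - 3)"
  proof (intro sum.cong refl)
    fix x assume "x \<in> L"
    from sum_dist_leaf[OF this]
    show "(\<Sum>y\<in>V. valency E y * broom_dist k x y) = (real k)\<^sup>2 + 3 * real p - 3"
      by (simp add: broom_dist_sym[of k x])
  qed
  moreover have "(\<Sum>t\<in>{1..<k}. (\<Sum>y\<in>V. valency E y * broom_dist k t y)
      + (\<Sum>y\<in>V. valency E y * broom_dist k (t + 1) y)) = (\<Sum>t\<in>{1..<k}. \<mu> t + \<mu> (t + 1))"
    by (intro sum.cong arg_cong2[where f = "(+)"] \<mu>) auto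
  moreover have "(\<Sum>y\<in>V. valency E y * broom_dist k k y) = (real k - 1)\<^sup>2 + real p"
    using \<mu>[of k] k3 by (simp add: \<mu>_def)
  ultimately show ?thesis
    unfolding sum_valency[of "\<lambda>x. \<Sum>y\<in>V. valency E y * broom_dist k x y"]
    using path[of k] k3 card_L by (simp add: algebra_simps)
qed

text \<open>All sums in \<open>kemeny_insert_edge\<close> are evaluated in closed form in terms of
  \<open>k\<close>, \<open>p\<close> and the distance \<open>c\<close> from \<open>i\<close> to the
  centre; what remains is \<open>broom_inequality\<close>.\<close>

theorem kemeny_insert_le:
  assumes i: "1 \<le> i" "i < k" and b: "b \<in> L" and "k \<le> p"
  shows "kemeny V (insert {i, b} E) \<le> kemeny V E"
proof -
  define c where "c = k - i"
  have k: "k = i + c" and c1: "1 \<le> c" using i by (auto simp: c_def)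
  \<comment> \<open>Distance from \<open>i\<close> of the projection of \<open>x\<close> onto the
    path from \<open>i\<close> to \<open>b\<close>: truncated subtraction gives \<open>0\<close>
    left of \<open>i\<close>, and the other leaves project to the centre. Taking
    \<open>C = c + 1\<close> normalises \<open>g i = 0\<close>.\<close>
  define g where "g x = (if x = b then real c + 1 else if k < x then real c else real (x - i))" for x
  have bk: "k < b" using L_gt[OF b] .
  have iV: "i \<in> V" and bV: "b \<in> V"
    using i b by (auto simp: broom_verts_def broom_path_def)
  have nE: "{i, b} \<notin> E"
    using i bk by (auto simp: mem_edges dest: L_gt)
  have ib: "broom_dist k i b = real c + 1"
    using i bk by (simp add: broom_dist_path_leaf k)
  have g: "2 * g x = broom_dist k x i - broom_dist k x b + (real c + 1)" if "x \<in> V" for x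
    using bk i by (auto simp: g_def k broom_dist_def of_nat_diff not_less)
  have gi: "g i = 0" and gb: "g b = real c + 1" and gk: "g k = real c"
    using i bk by (auto simp: g_def k)
  \<comment> \<open>For \<open>t < i\<close> the truncated terms vanish; from \<open>i\<close> on
    the summands are the odd numbers \<open>1, 3, 5, ...\<close>.\<close>
  have path1: "(\<Sum>t\<in>{1..<i + n}. real (t - i) + real (t + 1 - i)) = (real n)\<^sup>2" for n
    using i(1) by (induction n) (auto simp: power2_eq_square algebra_simps)
  have path2: "3 * (\<Sum>t\<in>{1..<i + n}. (real (t - i))\<^sup>2 + (real (t + 1 - i))\<^sup>2)
      = real n * (2 * (real n)\<^sup>2 + 1)" for n
    using i(1) by (induction n) (auto simp: algebra_simps power_numeral_reduce)
  have gpath: "g t = real (t - i)" if "t \<le> k" for t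
    using that bk by (auto simp: g_def)
  \<comment> \<open>Stated for a general \<open>f\<close>, as it serves both the identity and the
    square.\<close>
  have gL: "(\<Sum>x\<in>L. f (g x)) = (real p - 1) * f (real c) + f (real c + 1)" for f :: "real \<Rightarrow> real"
  proof -
    have "(\<Sum>x\<in>L. f (g x)) = (\<Sum>x\<in>L. f (real c) + (if x = b then f (real c + 1) - f (real c) else 0))"
      by (intro sum.cong refl) (auto simp: g_def dest: L_gt)
    then show ?thesis
      using b finite_L card_L by (simp add: sum.distrib algebra_simps)
  qed
  have "(\<Sum>t\<in>{1..<k}. g t + g (t + 1)) = (\<Sum>t\<in>{1..<i + c}. real (t - i) + real (t + 1 - i))"
    unfolding k by (intro sum.cong refl) (auto simp: gpath k)
  then have G1: "(\<Sum>x\<in>V. valency E x * g x) + g i + g b = (real c)\<^sup>2 + c + 2 + 2 * real p * c"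
    unfolding sum_valency using path1[of c] gL[of "\<lambda>x. x"] by (simp add: gi gb gk algebra_simps)
  have "(\<Sum>t\<in>{1..<k}. (g t)\<^sup>2 + (g (t + 1))\<^sup>2)
      = (\<Sum>t\<in>{1..<i + c}. (real (t - i))\<^sup>2 + (real (t + 1 - i))\<^sup>2)"
    unfolding k by (intro sum.cong refl) (auto simp: gpath k)
  then have G2: "3 * ((\<Sum>x\<in>V. valency E x * (g x)\<^sup>2) + (g i)\<^sup>2 + (g b)\<^sup>2)
      = c * (real c - 1) * (2 * real c - 1) + 6 * real p * (real c)\<^sup>2 + 6 * (real c + 1)\<^sup>2"
    unfolding sum_valency using path2[of c] gL[of "\<lambda>x. x\<^sup>2"]
    by (simp add: gi gb gk algebra_simps power_numeral_reduce)
  have vol: "2 * (volume + 2) = 4 * ((real k - 1 + real p) + 1)" "2 * volume = 4 * (real k - 1 + real p)"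
    by (simp_all add: volume_broom)
  have den: "1 + broom_dist k i b = real c + 2" by (simp add: ib)
  have ne: "i \<noteq> b" "broom_dist k i b \<noteq> - 1" using i bk ib by auto
  have T: "(\<Sum>x\<in>V. valency E x * broom_dist k x i) + (\<Sum>x\<in>V. valency E x * broom_dist k x b)
      + broom_dist k i b = (real k - real c - 1)\<^sup>2 + (real c)\<^sup>2 + real p * (2 * real c + 1)
        + ((real k)\<^sup>2 + 3 * real p - 3) + (real c + 1)"
    using i by (simp add: sum_dist_path sum_dist_leaf[OF b] ib c_def of_nat_diff)
  have ins: "kemeny V (insert {i, b} E) =
    ((\<Sum>x\<in>V. valency E x * (\<Sum>y\<in>V. valency E y * broom_dist k x y))
      + 2 * ((\<Sum>x\<in>V. valency E x * broom_dist k x i) + (\<Sum>x\<in>V. valency E x * broom_dist k x b)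
          + broom_dist k i b)
      - (2 * (volume + 2) * ((\<Sum>x\<in>V. valency E x * (g x)\<^sup>2) + (g i)\<^sup>2 + (g b)\<^sup>2)
          - 2 * ((\<Sum>x\<in>V. valency E x * g x) + g i + g b)\<^sup>2) / (1 + broom_dist k i b))
    / (2 * (volume + 2))"
    by (rule kemeny_insert_edge[OF iV bV ne(1) nE ne(2)]) (rule g)
  show ?thesis
    unfolding ins kemeny_eq vol den
    by (rule broom_inequality[OF _ _ _ _ sum_dist_dist T G1 G2 refl])
       (use c1 i k3 \<open>k \<le> p\<close> in \<open>auto simp: k\<close>)
qed

end

theorem theorem5p13:
  fixes k p :: nat
  assumes "3 \<le> k" and "k \<le> p"
  shows "(\<forall>i\<in>broom_path k. \<forall>j\<in>broom_leaves k p.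
            {i, j} \<notin> braess_edges (broom_verts k p) (broom_edges k p)) \<and>
         broom_B2 k p = 0"
proof -
  interpret broom k p
    using assms by unfold_locales auto
  have none: "{i, j} \<notin> braess_edges V E" if "i \<in> broom_path k" "j \<in> L" for i j
  proof
    assume "{i, j} \<in> braess_edges V E"
    then have *: "{i, j} \<notin> E" "kemeny V E < kemeny V (insert {i, j} E)"
      by (auto simp: braess_edges_def)
    \<comment> \<open>\<open>i = k\<close> is impossible, since the centre is already joined to
      every leaf.\<close>
    from *(1) that have "1 \<le> i" "i < k"
      by (auto simp: broom_path_def mem_edges nat_less_le)
    from kemeny_insert_le[OF this that(2) assms(2)] *(2) show False by simp
  qed
  \<comment> \<open>The set is empty, so its cardinality \<open>0\<close> is genuine and not the
    default that \<open>card\<close> gives to infinite sets.\<close>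
  then have "{e \<in> braess_edges V E. \<exists>i\<in>broom_path k. \<exists>j\<in>L. e = {i, j}} = {}"
    by blast
  with none show ?thesis
    by (simp only: broom_B2_def card.empty) blast
qed

end
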